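(* Let $R$ be an associative ring with unity, $M_R$ a unitary right $R$-module and $\sigma\in End(R)$. (1) If $M_R$ is a p.q.-Baer module and $M_R$ satisfies the condition $\mathcal{C}_2$, then $M[x;\sigma]_{R[x;\sigma]}$ is a p.q.-Baer module. (2) If $M[x;\sigma]_{R[x;\sigma]}$ or $M[[x;\sigma]]_{R[[x;\sigma]]}$ is a p.q.-Baer module and $M_R$ satisfies the condition $\mathcal{C}_1$, then $M_R$ is a p.q.-Baer module.
   Context: Rings are associative with unity and modules are unitary right modules. $End(R)$ is the set of ring endomorphisms $\sigma$ of $R$ with $\sigma(1)=1$. For a right $S$-module $N$ and $X\subseteq N$, $r_S(X)=\{a\in S: Xa=0\}$ is the right annihilator. A module $N_S$ (over any ring $S$) is called p.q.-Baer (principally quasi-Baer) if for every $n\in N$ there is an idempotent $e^2=e\in S$ with $r_S(nS)=eS$. $M_R$ satisfies $\mathcal{C}_1$ if for all $m\in M$, $a\in R$: $ma=0$ implies $m\sigma(a)=0$. $M_R$ satisfies $\mathcal{C}_2$ if for all $m\in M$, $a\in R$: $m\sigma(a)=0$ implies $ma=0$. $R[x;\sigma]$ is the skew polynomial ring (coefficients on the left, $xa=\sigma(a)x$) and $R[[x;\sigma]]$ the corresponding skew power series ring. $M[x;\sigma]=\{\sum_{i=0}^s m_ix^i: s\ge 0, m_i\in M\}$ is a right $R[x;\sigma]$-module with the obvious addition and the scalar product $\left(\sum_{i} m_ix^i\right)\left(\sum_{j} a_jx^j\right)=\sum_{k}\left(\sum_{i+j=k}m_i\sigma^i(a_j)\right)x^k$.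 Similarly $M[[x;\sigma]]=\{\sum_{i=0}^\infty m_ix^i: m_i\in M\}$ is a right $R[[x;\sigma]]$-module by the same formula. *)

theory Defs
  imports "HOL-Algebra.UnivPoly"
begin

section \<open>Right modules over a (not necessarily commutative) ring\<close>

text \<open>
  The locale \<open>module\<close> of HOL-Algebra is restricted to commutative rings, so unitary right
  modules are introduced here in the same style.  As there, only the additive part of the
  inherited ring record is meaningful.
\<close>

record ('a, 'm) right_module = "'m ring" +
  rsmult :: "['m, 'a] \<Rightarrow> 'm" (infixl \<open>\<cdot>\<index>\<close> 70)

locale right_module = R?: ring R + M?: abelian_group M
  for R :: "('a, 'r) ring_scheme" (structure)
    and M :: "('a, 'm, 'n) right_module_scheme" (structure) +
  assumes rsmult_closed [simp, intro]:
      "\<lbrakk>m \<in> carrier M; a \<in> carrier R\<rbrakk> \<Longrightarrow> m \<cdot>\<^bsub>M\<^esub> a \<in> carrier M"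
    and rsmult_l_distr:
      "\<lbrakk>m \<in> carrier M; n \<in> carrier M; a \<in> carrier R\<rbrakk>
        \<Longrightarrow> (m \<oplus>\<^bsub>M\<^esub> n) \<cdot>\<^bsub>M\<^esub> a = m \<cdot>\<^bsub>M\<^esub> a \<oplus>\<^bsub>M\<^esub> n \<cdot>\<^bsub>M\<^esub> a"
    and rsmult_r_distr:
      "\<lbrakk>m \<in> carrier M; a \<in> carrier R; b \<in> carrier R\<rbrakk>
        \<Longrightarrow> m \<cdot>\<^bsub>M\<^esub> (a \<oplus>\<^bsub>R\<^esub> b) = m \<cdot>\<^bsub>M\<^esub> a \<oplus>\<^bsub>M\<^esub> m \<cdot>\<^bsub>M\<^esub> b"
    and rsmult_assoc:
      "\<lbrakk>m \<in> carrier M; a \<in> carrier R; b \<in> carrier R\<rbrakk>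
        \<Longrightarrow> m \<cdot>\<^bsub>M\<^esub> (a \<otimes>\<^bsub>R\<^esub> b) = (m \<cdot>\<^bsub>M\<^esub> a) \<cdot>\<^bsub>M\<^esub> b"
    and rsmult_one [simp]:
      "m \<in> carrier M \<Longrightarrow> m \<cdot>\<^bsub>M\<^esub> \<one>\<^bsub>R\<^esub> = m"

definition right_ann ::
  "('a, 'r) ring_scheme \<Rightarrow> ('a, 'm, 'n) right_module_scheme \<Rightarrow> 'm set \<Rightarrow> 'a set" where
  "right_ann R M X = {a \<in> carrier R. \<forall>x\<in>X. x \<cdot>\<^bsub>M\<^esub> a = \<zero>\<^bsub>M\<^esub>}"

definition cyclic_submodule ::
  "('a, 'r) ring_scheme \<Rightarrow> ('a, 'm, 'n) right_module_scheme \<Rightarrow> 'm \<Rightarrow> 'm set" where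
  "cyclic_submodule R M m = {m \<cdot>\<^bsub>M\<^esub> a | a. a \<in> carrier R}"

locale pq_Baer_module = right_module +
  assumes pq_Baer:
    "m \<in> carrier M \<Longrightarrow>
      \<exists>e\<in>carrier R. e \<otimes>\<^bsub>R\<^esub> e = e \<and>
        right_ann R M (cyclic_submodule R M m) = e <#\<^bsub>R\<^esub> carrier R"

definition condition_C1 ::
  "('a, 'r) ring_scheme \<Rightarrow> ('a, 'm, 'n) right_module_scheme \<Rightarrow> ('a \<Rightarrow> 'a) \<Rightarrow> bool" where
  "condition_C1 R M \<sigma> \<longleftrightarrow>
    (\<forall>m\<in>carrier M. \<forall>a\<in>carrier R. m \<cdot>\<^bsub>M\<^esub> a = \<zero>\<^bsub>M\<^esub> \<longrightarrow> m \<cdot>\<^bsub>M\<^esub> \<sigma> a = \<zero>\<^bsub>M\<^esub>)"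

definition condition_C2 ::
  "('a, 'r) ring_scheme \<Rightarrow> ('a, 'm, 'n) right_module_scheme \<Rightarrow> ('a \<Rightarrow> 'a) \<Rightarrow> bool" where
  "condition_C2 R M \<sigma> \<longleftrightarrow>
    (\<forall>m\<in>carrier M. \<forall>a\<in>carrier R. m \<cdot>\<^bsub>M\<^esub> \<sigma> a = \<zero>\<^bsub>M\<^esub> \<longrightarrow> m \<cdot>\<^bsub>M\<^esub> a = \<zero>\<^bsub>M\<^esub>)"


section \<open>Skew polynomials and skew power series\<close>

text \<open>
  A series \<open>\<Sum>i. m\<^sub>i x\<^sup>i\<close> is its coefficient function \<open>nat \<Rightarrow> 'm\<close>; for polynomials the carrier
  is the set \<open>up\<close> of finitely supported coefficient functions from the library.  The same
  skew convolution (with \<open>x a = \<sigma>(a) x\<close>) serves as ring multiplication, where the action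
  is multiplication in the ring, and as scalar multiplication of the module.
\<close>

definition skew_conv ::
  "('m, 'n) ring_scheme \<Rightarrow> ('m \<Rightarrow> 'a \<Rightarrow> 'm) \<Rightarrow> ('a \<Rightarrow> 'a)
    \<Rightarrow> (nat \<Rightarrow> 'm) \<Rightarrow> (nat \<Rightarrow> 'a) \<Rightarrow> nat \<Rightarrow> 'm" where
  "skew_conv M act \<sigma> p q = (\<lambda>k. \<Oplus>\<^bsub>M\<^esub>i\<in>{..k}. act (p i) ((\<sigma> ^^ i) (q (k - i))))"

definition skew_ring_on ::
  "(nat \<Rightarrow> 'a) set \<Rightarrow> ('a, 'r) ring_scheme \<Rightarrow> ('a \<Rightarrow> 'a) \<Rightarrow> (nat \<Rightarrow> 'a) ring" where
  "skew_ring_on C R \<sigma> =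
    \<lparr>carrier = C,
     mult = skew_conv R (\<lambda>a b. a \<otimes>\<^bsub>R\<^esub> b) \<sigma>,
     one = (\<lambda>i. if i = 0 then \<one>\<^bsub>R\<^esub> else \<zero>\<^bsub>R\<^esub>),
     zero = (\<lambda>i. \<zero>\<^bsub>R\<^esub>),
     add = (\<lambda>p q i. p i \<oplus>\<^bsub>R\<^esub> q i)\<rparr>"

definition skew_module_on ::
  "(nat \<Rightarrow> 'm) set \<Rightarrow> ('a, 'm, 'n) right_module_scheme \<Rightarrow> ('a \<Rightarrow> 'a)
    \<Rightarrow> (nat \<Rightarrow> 'a, nat \<Rightarrow> 'm) right_module" where
  "skew_module_on C M \<sigma> =
    \<lparr>carrier = C,
     mult = undefined,
     one = undefined,
     zero = (\<lambda>i. \<zero>\<^bsub>M\<^esub>),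
     add = (\<lambda>p q i. p i \<oplus>\<^bsub>M\<^esub> q i),
     rsmult = skew_conv M (\<lambda>m a. m \<cdot>\<^bsub>M\<^esub> a) \<sigma>\<rparr>"

definition skew_poly_ring ::
  "('a, 'r) ring_scheme \<Rightarrow> ('a \<Rightarrow> 'a) \<Rightarrow> (nat \<Rightarrow> 'a) ring" where
  "skew_poly_ring R \<sigma> = skew_ring_on (up R) R \<sigma>"

definition skew_power_series_ring ::
  "('a, 'r) ring_scheme \<Rightarrow> ('a \<Rightarrow> 'a) \<Rightarrow> (nat \<Rightarrow> 'a) ring" where
  "skew_power_series_ring R \<sigma> = skew_ring_on (UNIV \<rightarrow> carrier R) R \<sigma>"

definition skew_poly_module ::
  "('a, 'm, 'n) right_module_scheme \<Rightarrow> ('a \<Rightarrow> 'a)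
    \<Rightarrow> (nat \<Rightarrow> 'a, nat \<Rightarrow> 'm) right_module" where
  "skew_poly_module M \<sigma> = skew_module_on (up M) M \<sigma>"

definition skew_power_series_module ::
  "('a, 'm, 'n) right_module_scheme \<Rightarrow> ('a \<Rightarrow> 'a)
    \<Rightarrow> (nat \<Rightarrow> 'a, nat \<Rightarrow> 'm) right_module" where
  "skew_power_series_module M \<sigma> = skew_module_on (UNIV \<rightarrow> carrier M) M \<sigma>"

end

theory Submission
  imports Defs
begin

text \<open>
  Suppose \<open>p r f = 0\<close> for all \<open>r \<in> R\<close>. If \<open>e\<close> is an idempotent generating the common
  annihilator of the first few \<open>p\<^sub>i R\<close>, substituting \<open>r e\<close> for \<open>r\<close> in the coefficient
  \<open>\<Sum>i + j = k. p\<^sub>i \<sigma>\<^sup>i(r f\<^sub>j)\<close> removes its first few terms and, by induction on \<open>k\<close>, leaves the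
  others unchanged. So every term vanishes, and \<open>C\<^sub>2\<close> yields \<open>p\<^sub>i r f\<^sub>j = 0\<close>. Hence a generator of the
  common annihilator of all the \<open>p\<^sub>i R\<close> also generates the annihilator of \<open>p R[x; \<sigma>]\<close>.
  In the other direction, the annihilator of \<open>m R\<close> is generated by the constant coefficient of a
  generator of the annihilator of \<open>m R[x; \<sigma>]\<close>.
\<close>

section \<open>Sums in abelian monoids\<close>

text \<open>Distributes every additive map that occurs later over finite sums: scalar multiplication
  in either argument and the powers of \<open>\<sigma>\<close>.\<close>

lemma (in abelian_monoid) finsum_hom:
  assumes "abelian_monoid H"
    and closed: "\<And>x. x \<in> carrier G \<Longrightarrow> h x \<in> carrier H"
    and zero: "h \<zero> = \<zero>\<^bsub>H\<^esub>"
    and add: "\<And>x y. x \<in> carrier G \<Longrightarrow> y \<in> carrier G \<Longrightarrow> h (x \<oplus> y) = h x \<oplus>\<^bsub>H\<^esub> h y"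
    and "finite A" and f: "f \<in> A \<rightarrow> carrier G"
  shows "h (finsum G f A) = finsum H (\<lambda>i. h (f i)) A"
  using \<open>finite A\<close> f
proof (induction A rule: finite_induct)
  interpret H: abelian_monoid H by fact
  case empty
  show ?case by (simp add: zero)
next
  interpret H: abelian_monoid H by fact
  case (insert a A)
  then show ?case
    by (simp add: Pi_iff closed add H.finsum_insert)
qed

lemma (in abelian_monoid) finsum_eq_zero:
  "(\<And>i. i \<in> A \<Longrightarrow> f i = \<zero>) \<Longrightarrow> finsum G f A = \<zero>"
  by (rule trans[OF finsum_cong'[OF refl, where g = "\<lambda>_. \<zero>"]]) auto

lemma (in abelian_monoid) finsum_delta:
  assumes "finite A" "i \<in> A" "f i \<in> carrier G"
    and "\<And>j. j \<in> A \<Longrightarrow> j \<noteq> i \<Longrightarrow> f j = \<zero>"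
  shows "finsum G f A = f i"
proof -
  have "finsum G f A = finsum G (\<lambda>j. if i = j then f i else \<zero>) A"
    by (rule finsum_cong') (use assms in auto)
  also have "\<dots> = f i"
    using add.finprod_singleton[of i A "\<lambda>_. f i"] assms by auto
  finally show ?thesis .
qed

text \<open>Both sides run over the pairs with \<open>l + j \<le> k\<close>, by diagonals on the
  left and by rows on the right. In the induction each old row gains one entry of the new diagonal,
  and the row \<open>l = Suc k\<close> has a single entry. This is the reindexing behind
  associativity.\<close>

lemma (in abelian_monoid) finsum_triangle:
  fixes k :: nat
  assumes f: "\<And>l j. f l j \<in> carrier G"
  shows "(\<Oplus>i\<in>{..k}. \<Oplus>l\<in>{..i}. f l (i - l)) = (\<Oplus>l\<in>{..k}. \<Oplus>j\<in>{..k - l}. f l j)"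
proof (induction k)
  case 0
  show ?case by (simp add: f)
next
  case (Suc k)
  have "(\<Oplus>l\<in>{..Suc k}. \<Oplus>j\<in>{..Suc k - l}. f l j)
      = f (Suc k) 0 \<oplus> (\<Oplus>l\<in>{..k}. \<Oplus>j\<in>{..Suc k - l}. f l j)"
    by (simp add: f Pi_iff)
  also have "(\<Oplus>l\<in>{..k}. \<Oplus>j\<in>{..Suc k - l}. f l j)
      = (\<Oplus>l\<in>{..k}. f l (Suc k - l) \<oplus> (\<Oplus>j\<in>{..k - l}. f l j))"
    by (rule finsum_cong') (auto simp: f Pi_iff Suc_diff_le)
  also have "\<dots> = (\<Oplus>l\<in>{..k}. f l (Suc k - l)) \<oplus> (\<Oplus>l\<in>{..k}. \<Oplus>j\<in>{..k - l}. f l j)"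
    by (rule finsum_addf) (auto simp: f Pi_iff)
  finally show ?case
    using Suc by (simp add: f Pi_iff a_assoc)
qed

section \<open>Right modules\<close>

context right_module
begin

lemma rsmult_l_null [simp]:
  assumes "a \<in> carrier R" shows "\<zero>\<^bsub>M\<^esub> \<cdot>\<^bsub>M\<^esub> a = \<zero>\<^bsub>M\<^esub>"
proof -
  have "\<zero>\<^bsub>M\<^esub> \<cdot>\<^bsub>M\<^esub> a \<oplus>\<^bsub>M\<^esub> \<zero>\<^bsub>M\<^esub> \<cdot>\<^bsub>M\<^esub> a = \<zero>\<^bsub>M\<^esub> \<cdot>\<^bsub>M\<^esub> a"
    using assms rsmult_l_distr[of "\<zero>\<^bsub>M\<^esub>" "\<zero>\<^bsub>M\<^esub>" a] by simp
  then show ?thesis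
    using assms M.add.l_cancel_one[of "\<zero>\<^bsub>M\<^esub> \<cdot>\<^bsub>M\<^esub> a" "\<zero>\<^bsub>M\<^esub> \<cdot>\<^bsub>M\<^esub> a"] by auto
qed

lemma rsmult_r_null [simp]:
  assumes "m \<in> carrier M" shows "m \<cdot>\<^bsub>M\<^esub> \<zero>\<^bsub>R\<^esub> = \<zero>\<^bsub>M\<^esub>"
proof -
  have "m \<cdot>\<^bsub>M\<^esub> \<zero>\<^bsub>R\<^esub> \<oplus>\<^bsub>M\<^esub> m \<cdot>\<^bsub>M\<^esub> \<zero>\<^bsub>R\<^esub> = m \<cdot>\<^bsub>M\<^esub> \<zero>\<^bsub>R\<^esub>"
    using assms rsmult_r_distr[of m "\<zero>\<^bsub>R\<^esub>" "\<zero>\<^bsub>R\<^esub>"] by simp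
  then show ?thesis
    using assms M.add.l_cancel_one[of "m \<cdot>\<^bsub>M\<^esub> \<zero>\<^bsub>R\<^esub>" "m \<cdot>\<^bsub>M\<^esub> \<zero>\<^bsub>R\<^esub>"] by auto
qed

lemma finsum_rsmult:
  assumes "finite A" "f \<in> A \<rightarrow> carrier M" "a \<in> carrier R"
  shows "finsum M f A \<cdot>\<^bsub>M\<^esub> a = (\<Oplus>\<^bsub>M\<^esub>i\<in>A. f i \<cdot>\<^bsub>M\<^esub> a)"
  by (rule M.finsum_hom[OF M.abelian_monoid_axioms])
    (use assms in \<open>auto simp: rsmult_l_distr\<close>)

lemma rsmult_finsum:
  assumes "finite A" "f \<in> A \<rightarrow> carrier R" "m \<in> carrier M"
  shows "m \<cdot>\<^bsub>M\<^esub> finsum R f A = (\<Oplus>\<^bsub>M\<^esub>i\<in>A. m \<cdot>\<^bsub>M\<^esub> f i)"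
  by (rule R.finsum_hom[OF M.abelian_monoid_axioms])
    (use assms in \<open>auto simp: rsmult_r_distr\<close>)

text \<open>An idempotent generates an annihilator iff it lies in it and acts on it as a left identity.\<close>

definition ann_generator :: "'m \<Rightarrow> 'a \<Rightarrow> bool" where
  "ann_generator m e \<longleftrightarrow> e \<in> carrier R \<and> (\<forall>r\<in>carrier R. (m \<cdot>\<^bsub>M\<^esub> r) \<cdot>\<^bsub>M\<^esub> e = \<zero>\<^bsub>M\<^esub>)
    \<and> (\<forall>b\<in>carrier R. (\<forall>r\<in>carrier R. (m \<cdot>\<^bsub>M\<^esub> r) \<cdot>\<^bsub>M\<^esub> b = \<zero>\<^bsub>M\<^esub>) \<longrightarrow> e \<otimes>\<^bsub>R\<^esub> b = b)"

lemma ann_generator_iff: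
  assumes m: "m \<in> carrier M"
  shows "ann_generator m e \<longleftrightarrow> e \<in> carrier R \<and> e \<otimes>\<^bsub>R\<^esub> e = e \<and>
    right_ann R M (cyclic_submodule R M m) = e <#\<^bsub>R\<^esub> carrier R"
proof -
  have ann: "b \<in> right_ann R M (cyclic_submodule R M m) \<longleftrightarrow>
      b \<in> carrier R \<and> (\<forall>r\<in>carrier R. (m \<cdot>\<^bsub>M\<^esub> r) \<cdot>\<^bsub>M\<^esub> b = \<zero>\<^bsub>M\<^esub>)" for b
    by (auto simp: right_ann_def cyclic_submodule_def)
  have coset: "b \<in> e <#\<^bsub>R\<^esub> carrier R \<longleftrightarrow> (\<exists>c\<in>carrier R. b = e \<otimes>\<^bsub>R\<^esub> c)" for b
    by (auto simp: l_coset_def)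
  show ?thesis
  proof
    assume g: "ann_generator m e"
    \<comment> \<open>Idempotence is the left identity property at \<open>b = e\<close>, since
      \<open>e\<close> itself lies in the annihilator.\<close>
    then have "e \<in> carrier R" "e \<otimes>\<^bsub>R\<^esub> e = e"
      by (auto simp: ann_generator_def)
    moreover have "b \<in> right_ann R M (cyclic_submodule R M m) \<longleftrightarrow> b \<in> e <#\<^bsub>R\<^esub> carrier R" for b
    proof
      assume "b \<in> right_ann R M (cyclic_submodule R M m)"
      then have "b \<in> carrier R" "b = e \<otimes>\<^bsub>R\<^esub> b"
        using g unfolding ann ann_generator_def by auto
      then show "b \<in> e <#\<^bsub>R\<^esub> carrier R"
        unfolding coset by blast
    next
      assume "b \<in> e <#\<^bsub>R\<^esub> carrier R"
      then show "b \<in> right_ann R M (cyclic_submodule R M m)"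
        using g m unfolding ann coset ann_generator_def by (auto simp: rsmult_assoc)
    qed
    ultimately show "e \<in> carrier R \<and> e \<otimes>\<^bsub>R\<^esub> e = e \<and>
        right_ann R M (cyclic_submodule R M m) = e <#\<^bsub>R\<^esub> carrier R"
      by blast
  next
    assume e: "e \<in> carrier R \<and> e \<otimes>\<^bsub>R\<^esub> e = e \<and>
        right_ann R M (cyclic_submodule R M m) = e <#\<^bsub>R\<^esub> carrier R"
    have "e \<in> right_ann R M (cyclic_submodule R M m)"
      using e coset by (metis (no_types))
    moreover have "e \<otimes>\<^bsub>R\<^esub> b = b" if "b \<in> right_ann R M (cyclic_submodule R M m)" for b
      using that e coset by (metis R.m_assoc)
    ultimately show "ann_generator m e"
      using ann by (simp add: ann_generator_def)
  qed
qed

lemma pq_Baer_module_iff: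
  "pq_Baer_module R M \<longleftrightarrow> (\<forall>m\<in>carrier M. \<exists>e. ann_generator m e)"
  unfolding pq_Baer_module_def pq_Baer_module_axioms_def
  using ann_generator_iff right_module_axioms by blast

end

section \<open>Skew polynomials over a module\<close>

text \<open>Ranging over all ring records, it serves for constants of \<open>M\<close> as well as of
  \<open>R\<close>; at the unit of \<open>R\<close> it is literally the unit of
  \<open>skew_ring_on\<close>.\<close>

abbreviation const :: "('a, 'r) ring_scheme \<Rightarrow> 'a \<Rightarrow> nat \<Rightarrow> 'a" where
  "const R a \<equiv> (\<lambda>i. if i = 0 then a else \<zero>\<^bsub>R\<^esub>)"

lemma const_mem_up:
  "\<lbrakk>a \<in> carrier R; \<zero>\<^bsub>R\<^esub> \<in> carrier R\<rbrakk> \<Longrightarrow> const R a \<in> up R"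
  by (auto intro!: exI[of _ 0])

lemma (in abelian_group) up_add_closed:
  assumes "p \<in> up G" "q \<in> up G"
  shows "(\<lambda>i. p i \<oplus> q i) \<in> up G"
proof -
  obtain n l where "bound \<zero> n p" "bound \<zero> l q"
    using assms by (auto simp: up_def)
  then have "bound \<zero> (max n l) (\<lambda>i. p i \<oplus> q i)"
    by (auto simp: bound_def)
  with assms show ?thesis
    by (auto intro!: mem_upI)
qed

lemma (in abelian_group) up_minus_closed:
  assumes "p \<in> up G"
  shows "(\<lambda>i. \<ominus> p i) \<in> up G"
proof -
  obtain n where "bound \<zero> n p"
    using assms by (auto simp: up_def)
  then have "bound \<zero> n (\<lambda>i. \<ominus> p i)"
    by (auto simp: bound_def)
  with assms show ?thesis
    by (auto intro!: mem_upI)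
qed

text \<open>Stated for any record \<open>P\<close> with coefficientwise addition, so that it applies
  both to \<open>skew_poly_ring\<close> and to \<open>skew_poly_module\<close>.\<close>

lemma (in abelian_group) abelian_group_up:
  assumes "carrier P = up G" "zero P = (\<lambda>i. \<zero>)" "add P = (\<lambda>p q i. p i \<oplus> q i)"
  shows "abelian_group P"
proof (rule abelian_groupI; unfold assms)
  fix p assume "p \<in> up G"
  then show "\<exists>q\<in>up G. (\<lambda>i. q i \<oplus> p i) = (\<lambda>i. \<zero>)"
    using up_minus_closed by (intro bexI[of _ "\<lambda>i. \<ominus> p i"]) (auto simp: l_neg mem_upD)
qed (auto simp: up_add_closed mem_upD a_ac fun_eq_iff bound_def)

locale skew_module = right_module R M
  for R :: "('a, 'r) ring_scheme" (structure)
    and M :: "('a, 'm, 'n) right_module_scheme" (structure) +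
  fixes \<sigma> :: "'a \<Rightarrow> 'a"
  assumes sigma_hom: "\<sigma> \<in> ring_hom R R"
begin

abbreviation act (infixl \<open>\<star>\<close> 70) where "p \<star> q \<equiv> skew_conv M (rsmult M) \<sigma> p q"

abbreviation rconv (infixl \<open>\<diamondop>\<close> 70) where "p \<diamondop> q \<equiv> skew_conv R (mult R) \<sigma> p q"

lemma sigma_pow_hom: "\<sigma> ^^ i \<in> ring_hom R R"
proof (induction i)
  case 0
  show ?case by (simp add: ring_hom_def)
next
  case (Suc i)
  then show ?case
    unfolding funpow.simps by (rule ring_hom_trans[OF _ sigma_hom])
qed

lemmas sigma_pow [simp] =
  ring_hom_closed[OF sigma_pow_hom] ring_hom_mult[OF sigma_pow_hom]
  ring_hom_add[OF sigma_pow_hom] ring_hom_one[OF sigma_pow_hom]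

lemma sigma_pow_zero [simp]: "(\<sigma> ^^ i) \<zero>\<^bsub>R\<^esub> = \<zero>\<^bsub>R\<^esub>"
  using ring_hom_zero[OF sigma_pow_hom R.ring_axioms R.ring_axioms] .

lemma conv_closed:
  assumes "\<And>i. p i \<in> carrier M" "\<And>i. q i \<in> carrier R"
  shows "(p \<star> q) k \<in> carrier M"
  unfolding skew_conv_def using assms by auto

lemma conv_up_closed:
  assumes p: "p \<in> up M" and q: "q \<in> up R"
  shows "p \<star> q \<in> up M"
proof -
  obtain n l where n: "bound \<zero>\<^bsub>M\<^esub> n p" and l: "bound \<zero>\<^bsub>R\<^esub> l q"
    using p q by (auto simp: up_def)
  have "(p \<star> q) k = \<zero>\<^bsub>M\<^esub>" if "k > n + l" for k
    unfolding skew_conv_def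
  proof (rule M.finsum_eq_zero)
    fix i
    show "p i \<cdot>\<^bsub>M\<^esub> (\<sigma> ^^ i) (q (k - i)) = \<zero>\<^bsub>M\<^esub>"
    proof (cases "i \<le> n")
      case True
      with that have "q (k - i) = \<zero>\<^bsub>R\<^esub>" by (intro bound.bound[OF l]) auto
      then show ?thesis using p by (simp add: mem_upD)
    next
      case False
      then have "p i = \<zero>\<^bsub>M\<^esub>" by (intro bound.bound[OF n]) auto
      then show ?thesis using q by (simp add: mem_upD)
    qed
  qed
  then show ?thesis
    using p q by (auto intro!: mem_upI exI[of _ "n + l"] conv_closed simp: mem_upD)
qed

lemma conv_const_left:
  assumes "m \<in> carrier M" "\<And>i. q i \<in> carrier R"
  shows "const M m \<star> q = (\<lambda>k. m \<cdot>\<^bsub>M\<^esub> q k)"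
proof
  fix k
  show "(const M m \<star> q) k = m \<cdot>\<^bsub>M\<^esub> q k"
    unfolding skew_conv_def
    by (rule trans[OF M.finsum_delta[where i = 0]]) (use assms in auto)
qed

lemma conv_const_right:
  assumes "\<And>i. p i \<in> carrier M" "a \<in> carrier R"
  shows "p \<star> const R a = (\<lambda>k. p k \<cdot>\<^bsub>M\<^esub> (\<sigma> ^^ k) a)"
proof
  fix k
  show "(p \<star> const R a) k = p k \<cdot>\<^bsub>M\<^esub> (\<sigma> ^^ k) a"
    unfolding skew_conv_def
    by (rule trans[OF M.finsum_delta[where i = k]]) (use assms in auto)
qed

lemma conv_l_distr:
  assumes "\<And>i. p i \<in> carrier M" "\<And>i. p' i \<in> carrier M" "\<And>i. q i \<in> carrier R"
  shows "(\<lambda>i. p i \<oplus>\<^bsub>M\<^esub> p' i) \<star> q = (\<lambda>i. (p \<star> q) i \<oplus>\<^bsub>M\<^esub> (p' \<star> q) i)"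
  unfolding skew_conv_def
  by (rule ext, subst M.finsum_addf[symmetric]) (use assms in \<open>auto simp: rsmult_l_distr\<close>)

lemma conv_r_distr:
  assumes "\<And>i. p i \<in> carrier M" "\<And>i. q i \<in> carrier R" "\<And>i. q' i \<in> carrier R"
  shows "p \<star> (\<lambda>i. q i \<oplus>\<^bsub>R\<^esub> q' i) = (\<lambda>i. (p \<star> q) i \<oplus>\<^bsub>M\<^esub> (p \<star> q') i)"
  unfolding skew_conv_def
  by (rule ext, subst M.finsum_addf[symmetric]) (use assms in \<open>auto simp: rsmult_r_distr\<close>)

lemma conv_assoc:
  assumes p: "\<And>i. p i \<in> carrier M" and q: "\<And>i. q i \<in> carrier R" and s: "\<And>i. s i \<in> carrier R"
  shows "p \<star> (q \<diamondop> s) = (p \<star> q) \<star> s"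
proof
  fix k
  \<comment> \<open>The common summand of both sides in degree \<open>k\<close>: the degrees taken
    from \<open>p\<close>, \<open>q\<close> and \<open>s\<close> are \<open>l\<close>,
    \<open>j\<close> and \<open>k - (l + j)\<close>. Only the order of summation over the triangle
    differs.\<close>
  define f where "f l j = (p l \<cdot>\<^bsub>M\<^esub> (\<sigma> ^^ l) (q j)) \<cdot>\<^bsub>M\<^esub> (\<sigma> ^^ (l + j)) (s (k - (l + j)))" for l j
  have f: "f l j \<in> carrier M" for l j
    using assms by (simp add: f_def)
  have "((p \<star> q) \<star> s) k = (\<Oplus>\<^bsub>M\<^esub>i\<in>{..k}. \<Oplus>\<^bsub>M\<^esub>l\<in>{..i}. f l (i - l))"
    unfolding skew_conv_def
  proof (rule M.finsum_cong'[OF refl])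
    fix i
    show "(\<Oplus>\<^bsub>M\<^esub>l\<in>{..i}. p l \<cdot>\<^bsub>M\<^esub> (\<sigma> ^^ l) (q (i - l))) \<cdot>\<^bsub>M\<^esub> (\<sigma> ^^ i) (s (k - i))
        = (\<Oplus>\<^bsub>M\<^esub>l\<in>{..i}. f l (i - l))"
      by (subst finsum_rsmult) (auto simp: f_def assms intro!: M.finsum_cong')
  qed (auto simp: f)
  also have "\<dots> = (\<Oplus>\<^bsub>M\<^esub>l\<in>{..k}. \<Oplus>\<^bsub>M\<^esub>j\<in>{..k - l}. f l j)"
    by (rule M.finsum_triangle) (rule f)
  also have "\<dots> = (p \<star> (q \<diamondop> s)) k"
    unfolding skew_conv_def
  proof (rule M.finsum_cong'[OF refl])
    fix l
    have c: "(\<lambda>j. q j \<otimes>\<^bsub>R\<^esub> (\<sigma> ^^ j) (s (k - l - j))) \<in> {..k - l} \<rightarrow> carrier R"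
      using assms by auto
    have "p l \<cdot>\<^bsub>M\<^esub> (\<sigma> ^^ l) (\<Oplus>\<^bsub>R\<^esub>j\<in>{..k - l}. q j \<otimes>\<^bsub>R\<^esub> (\<sigma> ^^ j) (s (k - l - j)))
        = p l \<cdot>\<^bsub>M\<^esub> (\<Oplus>\<^bsub>R\<^esub>j\<in>{..k - l}. (\<sigma> ^^ l) (q j \<otimes>\<^bsub>R\<^esub> (\<sigma> ^^ j) (s (k - l - j))))"
      by (subst R.finsum_hom[OF R.abelian_monoid_axioms, where h = "\<sigma> ^^ l"]) (use c in auto)
    also have "\<dots> = (\<Oplus>\<^bsub>M\<^esub>j\<in>{..k - l}. p l \<cdot>\<^bsub>M\<^esub> (\<sigma> ^^ l) (q j \<otimes>\<^bsub>R\<^esub> (\<sigma> ^^ j) (s (k - l - j))))"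
      by (rule rsmult_finsum) (use assms in auto)
    also have "\<dots> = (\<Oplus>\<^bsub>M\<^esub>j\<in>{..k - l}. f l j)"
      by (rule M.finsum_cong'[OF refl]) (auto simp: f f_def assms rsmult_assoc funpow_add)
    finally show "(\<Oplus>\<^bsub>M\<^esub>j\<in>{..k - l}. f l j)
        = p l \<cdot>\<^bsub>M\<^esub> (\<sigma> ^^ l) (\<Oplus>\<^bsub>R\<^esub>j\<in>{..k - l}. q j \<otimes>\<^bsub>R\<^esub> (\<sigma> ^^ j) (s (k - l - j)))" ..
  qed (auto simp: assms)
  finally show "(p \<star> (q \<diamondop> s)) k = ((p \<star> q) \<star> s) k" ..
qed

end

section \<open>The coefficient ring as a right module over itself\<close>

definition regular_module :: "('a, 'r) ring_scheme \<Rightarrow> ('a, 'a) right_module" where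
  "regular_module R = \<lparr>carrier = carrier R, mult = mult R, one = \<one>\<^bsub>R\<^esub>, zero = \<zero>\<^bsub>R\<^esub>,
    add = add R, rsmult = mult R\<rparr>"

lemma regular_module_simps [simp]:
  "carrier (regular_module R) = carrier R" "zero (regular_module R) = \<zero>\<^bsub>R\<^esub>"
  "add (regular_module R) = add R" "rsmult (regular_module R) = mult R"
  by (simp_all add: regular_module_def)

lemma finsum_regular_module [simp]: "finsum (regular_module R) = finsum R"
  by (simp add: finsum_def finprod_def fun_eq_iff)

lemma skew_conv_regular_module [simp]: "skew_conv (regular_module R) = skew_conv R"
  by (simp add: skew_conv_def fun_eq_iff)

lemma up_regular_module [simp]: "up (regular_module R) = up R"
  by (simp add: up_def)

lemma (in ring) right_module_regular: "right_module R (regular_module R)"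
proof -
  have "abelian_group (regular_module R)"
    by (rule abelian_groupI) (auto simp: a_ac intro: bexI[of _ "\<ominus> _"] r_neg)
  then show ?thesis
    by (intro right_module.intro ring_axioms right_module_axioms.intro)
      (auto simp: l_distr r_distr m_assoc)
qed

context skew_module
begin

text \<open>Over the regular module \<open>\<star>\<close> becomes \<open>\<diamondop>\<close>, so
  each law of the module action yields the corresponding law of the ring multiplication.\<close>

lemma skew_module_regular: "skew_module R (regular_module R) \<sigma>"
  by (intro skew_module.intro R.right_module_regular skew_module_axioms.intro sigma_hom)

lemmas rconv_const_left = skew_module.conv_const_left[OF skew_module_regular,
    unfolded regular_module_simps skew_conv_regular_module]
  and rconv_const_right = skew_module.conv_const_right[OF skew_module_regular,
    unfolded regular_module_simps skew_conv_regular_module]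

lemma ring_skew_poly: "ring (skew_poly_ring R \<sigma>)"
proof (rule ringI)
  interpret Reg: skew_module R "regular_module R" \<sigma>
    by (rule skew_module_regular)
  show "abelian_group (skew_poly_ring R \<sigma>)"
    by (rule R.abelian_group_up) (simp_all add: skew_poly_ring_def skew_ring_on_def)
  show "monoid (skew_poly_ring R \<sigma>)"
    using Reg.conv_up_closed Reg.conv_assoc rconv_const_left rconv_const_right
    by (auto intro!: monoidI const_mem_up simp: skew_poly_ring_def skew_ring_on_def mem_upD)
qed (use skew_module.conv_l_distr[OF skew_module_regular]
      skew_module.conv_r_distr[OF skew_module_regular] in
    \<open>auto simp: skew_poly_ring_def skew_ring_on_def mem_upD\<close>)

text \<open>\<open>pq_Baer_module\<close> contains the ring and module axioms, so the passage to
  skew polynomials has to establish them.\<close>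

lemma right_module_skew_poly: "right_module (skew_poly_ring R \<sigma>) (skew_poly_module M \<sigma>)"
proof (intro right_module.intro right_module_axioms.intro ring_skew_poly)
  show "abelian_group (skew_poly_module M \<sigma>)"
    by (rule M.abelian_group_up) (simp_all add: skew_poly_module_def skew_module_on_def)
qed (simp_all add: skew_poly_module_def skew_module_on_def skew_poly_ring_def skew_ring_on_def
    conv_up_closed conv_l_distr conv_r_distr conv_assoc conv_const_right mem_upD)

section \<open>Passing from the module to skew polynomials\<close>

lemma C2_pow:
  assumes "condition_C2 R M \<sigma>" "m \<in> carrier M" "a \<in> carrier R"
  shows "m \<cdot>\<^bsub>M\<^esub> (\<sigma> ^^ i) a = \<zero>\<^bsub>M\<^esub> \<Longrightarrow> m \<cdot>\<^bsub>M\<^esub> a = \<zero>\<^bsub>M\<^esub>"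
  using assms by (induction i) (auto simp: condition_C2_def)

text \<open>
  For idempotents, \<open>C\<^sub>2\<close> implies a form of \<open>C\<^sub>1\<close>: from \<open>m \<sigma>(e) \<sigma>(1 - e) = 0\<close> one gets
  \<open>m \<sigma>(e) = m \<sigma>(e) e\<close>, and the right-hand side vanishes because \<open>m R e = 0\<close>.
\<close>

lemma C2_idem:
  assumes C2: "condition_C2 R M \<sigma>" and m: "m \<in> carrier M"
    and e: "e \<in> carrier R" "e \<otimes>\<^bsub>R\<^esub> e = e"
    and ann: "\<And>r. r \<in> carrier R \<Longrightarrow> (m \<cdot>\<^bsub>M\<^esub> r) \<cdot>\<^bsub>M\<^esub> e = \<zero>\<^bsub>M\<^esub>"
    and r: "r \<in> carrier R"
  shows "(m \<cdot>\<^bsub>M\<^esub> r) \<cdot>\<^bsub>M\<^esub> \<sigma> e = \<zero>\<^bsub>M\<^esub>"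
proof -
  have s: "\<sigma> a \<in> carrier R" if "a \<in> carrier R" for a
    using that sigma_pow(1)[of a 1] by simp
  define n where "n = (m \<cdot>\<^bsub>M\<^esub> r) \<cdot>\<^bsub>M\<^esub> \<sigma> e"
  have n: "n \<in> carrier M" using m e r s by (simp add: n_def)
  have "e \<otimes>\<^bsub>R\<^esub> (\<one>\<^bsub>R\<^esub> \<ominus>\<^bsub>R\<^esub> e) = \<zero>\<^bsub>R\<^esub>"
    using e by (simp add: a_minus_def R.r_distr R.r_minus R.r_neg)
  then have "\<sigma> e \<otimes>\<^bsub>R\<^esub> \<sigma> (\<one>\<^bsub>R\<^esub> \<ominus>\<^bsub>R\<^esub> e) = \<zero>\<^bsub>R\<^esub>"
    using sigma_pow(2)[of e "\<one>\<^bsub>R\<^esub> \<ominus>\<^bsub>R\<^esub> e" 1] sigma_pow_zero[of 1] e by simp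
  then have "n \<cdot>\<^bsub>M\<^esub> \<sigma> (\<one>\<^bsub>R\<^esub> \<ominus>\<^bsub>R\<^esub> e) = \<zero>\<^bsub>M\<^esub>"
    using m e r s by (simp add: n_def R.m_assoc flip: rsmult_assoc)
  then have "n \<cdot>\<^bsub>M\<^esub> (\<one>\<^bsub>R\<^esub> \<ominus>\<^bsub>R\<^esub> e) = \<zero>\<^bsub>M\<^esub>"
    using C2 n e by (simp add: condition_C2_def)
  moreover have "n \<cdot>\<^bsub>M\<^esub> e = \<zero>\<^bsub>M\<^esub>"
    using ann[of "r \<otimes>\<^bsub>R\<^esub> \<sigma> e"] m e r s by (simp add: n_def rsmult_assoc)
  moreover have "n = n \<cdot>\<^bsub>M\<^esub> (\<one>\<^bsub>R\<^esub> \<ominus>\<^bsub>R\<^esub> e) \<oplus>\<^bsub>M\<^esub> n \<cdot>\<^bsub>M\<^esub> e"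
    using n e rsmult_r_distr[of n "\<one>\<^bsub>R\<^esub> \<ominus>\<^bsub>R\<^esub> e" e]
    by (simp add: a_minus_def R.a_assoc R.l_neg)
  ultimately show ?thesis
    using n by (simp add: n_def)
qed

text \<open>\<open>C2_idem\<close> can be iterated because \<open>(\<sigma> ^^ i) e\<close> is again
  idempotent and, by the induction hypothesis for all \<open>r\<close>, again annihilates
  \<open>m R\<close>.\<close>

lemma C2_idem_pow:
  assumes C2: "condition_C2 R M \<sigma>" and m: "m \<in> carrier M"
    and e: "e \<in> carrier R" "e \<otimes>\<^bsub>R\<^esub> e = e"
    and ann: "\<And>r. r \<in> carrier R \<Longrightarrow> (m \<cdot>\<^bsub>M\<^esub> r) \<cdot>\<^bsub>M\<^esub> e = \<zero>\<^bsub>M\<^esub>"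
  shows "r \<in> carrier R \<Longrightarrow> (m \<cdot>\<^bsub>M\<^esub> r) \<cdot>\<^bsub>M\<^esub> (\<sigma> ^^ i) e = \<zero>\<^bsub>M\<^esub>"
proof (induction i arbitrary: r)
  case 0
  then show ?case using ann by simp
next
  case (Suc i)
  have "(\<sigma> ^^ i) e \<otimes>\<^bsub>R\<^esub> (\<sigma> ^^ i) e = (\<sigma> ^^ i) e"
    using sigma_pow(2)[of e e i] e by simp
  then show ?case
    using C2_idem[OF C2 m, of "(\<sigma> ^^ i) e" r] Suc e by simp
qed

text \<open>Generators are multiplied one after another: if \<open>e\<close> serves for the indices
  below \<open>t\<close> and \<open>g\<close> generates the annihilator of \<open>p t R\<close>,
  then \<open>e g\<close> serves below \<open>Suc t\<close>. An element \<open>b\<close> of the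
  common annihilator satisfies \<open>g b = b\<close> and then \<open>e b = b\<close>.\<close>

lemma common_ann_generator:
  fixes p :: "nat \<Rightarrow> 'm" and t :: nat
  assumes "pq_Baer_module R M" and p: "\<And>i. p i \<in> carrier M"
  obtains e where "e \<in> carrier R" "e \<otimes>\<^bsub>R\<^esub> e = e"
    "\<And>i r. i < t \<Longrightarrow> r \<in> carrier R \<Longrightarrow> (p i \<cdot>\<^bsub>M\<^esub> r) \<cdot>\<^bsub>M\<^esub> e = \<zero>\<^bsub>M\<^esub>"
    "\<forall>b\<in>carrier R. (\<forall>i<t. \<forall>r\<in>carrier R. (p i \<cdot>\<^bsub>M\<^esub> r) \<cdot>\<^bsub>M\<^esub> b = \<zero>\<^bsub>M\<^esub>) \<longrightarrow> e \<otimes>\<^bsub>R\<^esub> b = b"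
proof -
  let ?ann = "\<lambda>t e. \<forall>i<t. \<forall>r\<in>carrier R. (p i \<cdot>\<^bsub>M\<^esub> r) \<cdot>\<^bsub>M\<^esub> e = \<zero>\<^bsub>M\<^esub>"
  let ?id = "\<lambda>t e. \<forall>b\<in>carrier R. ?ann t b \<longrightarrow> e \<otimes>\<^bsub>R\<^esub> b = b"
  have "\<exists>e\<in>carrier R. ?ann t e \<and> ?id t e"
  proof (induction t)
    case 0
    show ?case by (intro bexI[of _ "\<one>\<^bsub>R\<^esub>"]) auto
  next
    case (Suc t)
    then obtain e where e: "e \<in> carrier R" "?ann t e" "?id t e" by blast
    obtain g where g: "ann_generator (p t) g"
      using assms unfolding pq_Baer_module_iff by blast
    then have gR: "g \<in> carrier R" by (simp add: ann_generator_def)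
    have "(p i \<cdot>\<^bsub>M\<^esub> r) \<cdot>\<^bsub>M\<^esub> (e \<otimes>\<^bsub>R\<^esub> g) = \<zero>\<^bsub>M\<^esub>" if "i < Suc t" "r \<in> carrier R" for i r
    proof (cases "i = t")
      case True
      \<comment> \<open>\<open>e\<close> stands to the left of \<open>g\<close>, but it is absorbed
        into the multiplier: \<open>r e\<close> is just another element of \<open>R\<close>.\<close>
      have "(p t \<cdot>\<^bsub>M\<^esub> (r \<otimes>\<^bsub>R\<^esub> e)) \<cdot>\<^bsub>M\<^esub> g = \<zero>\<^bsub>M\<^esub>"
        using g e that by (simp add: ann_generator_def)
      then show ?thesis using True e gR p that by (simp add: rsmult_assoc)
    next
      case False
      then show ?thesis using e gR p that by (simp add: rsmult_assoc)
    qed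
    moreover have "(e \<otimes>\<^bsub>R\<^esub> g) \<otimes>\<^bsub>R\<^esub> b = b"
      if "b \<in> carrier R" "\<forall>i<Suc t. \<forall>r\<in>carrier R. (p i \<cdot>\<^bsub>M\<^esub> r) \<cdot>\<^bsub>M\<^esub> b = \<zero>\<^bsub>M\<^esub>" for b
      using that g gR e by (simp add: ann_generator_def R.m_assoc)
    ultimately show ?case
      using e gR by (intro bexI[of _ "e \<otimes>\<^bsub>R\<^esub> g"]) auto
  qed
  then obtain e where e: "e \<in> carrier R" "?ann t e" "?id t e" by blast
  then have "e \<otimes>\<^bsub>R\<^esub> e = e" by blast
  with e show ?thesis by (intro that[of e]) simp_all
qed

text \<open>The freedom to vary \<open>r\<close> in \<open>ann\<close> separates the terms of one
  coefficient. The induction is on the total degree \<open>i + j\<close>.\<close>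

lemma coeffwise_ann:
  assumes pq: "pq_Baer_module R M" and C2: "condition_C2 R M \<sigma>"
    and p: "\<And>i. p i \<in> carrier M" and f: "\<And>j. f j \<in> carrier R"
    and ann: "\<And>r k. r \<in> carrier R \<Longrightarrow> (p \<star> (\<lambda>j. r \<otimes>\<^bsub>R\<^esub> f j)) k = \<zero>\<^bsub>M\<^esub>"
  shows "r \<in> carrier R \<Longrightarrow> (p i \<cdot>\<^bsub>M\<^esub> r) \<cdot>\<^bsub>M\<^esub> f j = \<zero>\<^bsub>M\<^esub>"
proof (induction "i + j" arbitrary: i j r rule: less_induct)
  case less
  define k where "k = i + j"
  define T where "T r l = p l \<cdot>\<^bsub>M\<^esub> (\<sigma> ^^ l) (r \<otimes>\<^bsub>R\<^esub> f (k - l))" for r l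
  have T: "T r l \<in> carrier M" if "r \<in> carrier R" for r l
    using that p f by (simp add: T_def)
  \<comment> \<open>A truncated coefficient \<open>k\<close> of \<open>p \<star> (r f)\<close>. Once
    all truncations vanish, comparing two consecutive ones isolates a single term.\<close>
  define tail where "tail t = (\<Oplus>\<^bsub>M\<^esub>l\<in>{..k}. if l < t then \<zero>\<^bsub>M\<^esub> else T r l)" for t
  \<comment> \<open>Replacing \<open>r\<close> by \<open>r e\<close>, with \<open>e\<close> generating the common annihilator of
    \<open>p\<^sub>l R\<close> for \<open>l < t\<close>, kills the terms below \<open>t\<close> and fixes the others.\<close>
  have tail: "tail t = \<zero>\<^bsub>M\<^esub>" for t
  proof -
    obtain e where e: "e \<in> carrier R" "e \<otimes>\<^bsub>R\<^esub> e = e"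
      and kill: "\<And>l r. l < t \<Longrightarrow> r \<in> carrier R \<Longrightarrow> (p l \<cdot>\<^bsub>M\<^esub> r) \<cdot>\<^bsub>M\<^esub> e = \<zero>\<^bsub>M\<^esub>"
      and fixd: "\<forall>b\<in>carrier R. (\<forall>l<t. \<forall>r\<in>carrier R. (p l \<cdot>\<^bsub>M\<^esub> r) \<cdot>\<^bsub>M\<^esub> b = \<zero>\<^bsub>M\<^esub>) \<longrightarrow> e \<otimes>\<^bsub>R\<^esub> b = b"
      by (rule common_ann_generator[OF pq, of p t, OF p]) (rule that)
    have "(if l < t then \<zero>\<^bsub>M\<^esub> else T r l) = T (r \<otimes>\<^bsub>R\<^esub> e) l" if l: "l \<le> k" for l
    proof (cases "l < t")
      case True
      have "T (r \<otimes>\<^bsub>R\<^esub> e) l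
          = ((p l \<cdot>\<^bsub>M\<^esub> (\<sigma> ^^ l) r) \<cdot>\<^bsub>M\<^esub> (\<sigma> ^^ l) e) \<cdot>\<^bsub>M\<^esub> (\<sigma> ^^ l) (f (k - l))"
        using less.prems e p f by (simp add: T_def rsmult_assoc)
      \<comment> \<open>The substitution puts \<open>e\<close> under \<open>\<sigma> ^^ l\<close>;
        as \<open>e\<close> is idempotent, \<open>C\<^sub>2\<close> carries the annihilation over to
        \<open>(\<sigma> ^^ l) e\<close>.\<close>
      also have "(p l \<cdot>\<^bsub>M\<^esub> (\<sigma> ^^ l) r) \<cdot>\<^bsub>M\<^esub> (\<sigma> ^^ l) e = \<zero>\<^bsub>M\<^esub>"
        using C2_idem_pow[OF C2 p e kill] True less.prems by simp
      finally show ?thesis using True f by simp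
    next
      case False
      \<comment> \<open>For \<open>l' < t \<le> l\<close> the degree \<open>l' + (k - l)\<close> is
        below \<open>k\<close>, so the induction hypothesis puts \<open>f (k - l)\<close> into the
        common annihilator, which \<open>e\<close> fixes.\<close>
      have "e \<otimes>\<^bsub>R\<^esub> f (k - l) = f (k - l)"
      proof (rule fixd[rule_format])
        fix l' r' assume "l' < t" "r' \<in> carrier R"
        then show "(p l' \<cdot>\<^bsub>M\<^esub> r') \<cdot>\<^bsub>M\<^esub> f (k - l) = \<zero>\<^bsub>M\<^esub>"
          using False l by (intro less.hyps) (auto simp: k_def)
      qed (rule f)
      then show ?thesis
        using False less.prems e f by (simp add: T_def R.m_assoc del: sigma_pow)
    qed
    then have "tail t = (\<Oplus>\<^bsub>M\<^esub>l\<in>{..k}. T (r \<otimes>\<^bsub>R\<^esub> e) l)"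
      unfolding tail_def using T less.prems e by (intro M.finsum_cong') auto
    \<comment> \<open>This is the full coefficient \<open>k\<close> for the multiplier
      \<open>r e\<close>, zero by \<open>ann\<close>.\<close>
    also have "\<dots> = \<zero>\<^bsub>M\<^esub>"
      using ann[of "r \<otimes>\<^bsub>R\<^esub> e" k] less.prems e by (simp add: skew_conv_def T_def del: sigma_pow)
    finally show ?thesis .
  qed
  \<comment> \<open>The tails from \<open>i\<close> and from \<open>Suc i\<close> differ by
    \<open>T r i\<close> alone, so this term vanishes too.\<close>
  have "tail i = (\<Oplus>\<^bsub>M\<^esub>l\<in>{..k}. (if l < Suc i then \<zero>\<^bsub>M\<^esub> else T r l)
      \<oplus>\<^bsub>M\<^esub> (if l = i then T r i else \<zero>\<^bsub>M\<^esub>))"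
    unfolding tail_def using T less.prems by (intro M.finsum_cong') auto
  also have "\<dots> = tail (Suc i) \<oplus>\<^bsub>M\<^esub> (\<Oplus>\<^bsub>M\<^esub>l\<in>{..k}. if l = i then T r i else \<zero>\<^bsub>M\<^esub>)"
    unfolding tail_def using T less.prems by (intro M.finsum_addf) auto
  also have "(\<Oplus>\<^bsub>M\<^esub>l\<in>{..k}. if l = i then T r i else \<zero>\<^bsub>M\<^esub>) = T r i"
    by (rule trans[OF M.finsum_delta[where i = i]]) (use T less.prems in \<open>auto simp: k_def\<close>)
  finally have "p i \<cdot>\<^bsub>M\<^esub> (\<sigma> ^^ i) (r \<otimes>\<^bsub>R\<^esub> f j) = \<zero>\<^bsub>M\<^esub>"
    using tail T[of r i] less.prems by (simp add: T_def k_def del: sigma_pow)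
  then have "p i \<cdot>\<^bsub>M\<^esub> (r \<otimes>\<^bsub>R\<^esub> f j) = \<zero>\<^bsub>M\<^esub>"
    using C2_pow[OF C2 p] less.prems f by blast
  then show ?case
    using p f less.prems by (simp add: rsmult_assoc)
qed

text \<open>The constant polynomial \<open>e\<close>, with \<open>e\<close> generating the common
  annihilator of all \<open>p i R\<close>, is the required generator: by
  \<open>coeffwise_ann\<close>, every coefficient of an annihilating \<open>f\<close> is fixed by
  \<open>e\<close>.\<close>

lemma pq_Baer_skew_poly:
  assumes pq: "pq_Baer_module R M" and C2: "condition_C2 R M \<sigma>"
  shows "pq_Baer_module (skew_poly_ring R \<sigma>) (skew_poly_module M \<sigma>)"
proof -
  interpret P: right_module "skew_poly_ring R \<sigma>" "skew_poly_module M \<sigma>"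
    by (rule right_module_skew_poly)
  have "\<exists>e. P.ann_generator p e" if p: "p \<in> up M" for p
  proof -
    note pM = mem_upD[OF p]
    obtain n where n: "bound \<zero>\<^bsub>M\<^esub> n p" using p by (auto simp: up_def)
    \<comment> \<open>Coefficients beyond \<open>n\<close> vanish, so the indices below
      \<open>Suc n\<close> account for all of \<open>p\<close>.\<close>
    obtain e where e: "e \<in> carrier R" "e \<otimes>\<^bsub>R\<^esub> e = e"
      and kill: "\<And>l r. l < Suc n \<Longrightarrow> r \<in> carrier R \<Longrightarrow> (p l \<cdot>\<^bsub>M\<^esub> r) \<cdot>\<^bsub>M\<^esub> e = \<zero>\<^bsub>M\<^esub>"
      and fixd: "\<forall>b\<in>carrier R. (\<forall>l<Suc n. \<forall>r\<in>carrier R. (p l \<cdot>\<^bsub>M\<^esub> r) \<cdot>\<^bsub>M\<^esub> b = \<zero>\<^bsub>M\<^esub>) \<longrightarrow> e \<otimes>\<^bsub>R\<^esub> b = b"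
      by (rule common_ann_generator[OF pq, of p "Suc n", OF pM]) (rule that)
    have "p i \<cdot>\<^bsub>M\<^esub> r \<cdot>\<^bsub>M\<^esub> e = \<zero>\<^bsub>M\<^esub>" if "r \<in> carrier R" for i r
      using kill[of i r] that e bound.bound[OF n, of i] by (cases "i \<le> n") auto
    \<comment> \<open>Right multiplication by the constant \<open>e\<close> acts in degree
      \<open>k\<close> through \<open>(\<sigma> ^^ k) e\<close>, so all powers of
      \<open>\<sigma>\<close> have to be covered.\<close>
    note kill = C2_idem_pow[OF C2 pM e this]
    have "((p \<star> g) \<star> const R e) = (\<lambda>k. \<zero>\<^bsub>M\<^esub>)" if g: "g \<in> up R" for g
    proof
      fix k
      note gR = mem_upD[OF g]
      have "((p \<star> g) \<star> const R e) k = (p \<star> g) k \<cdot>\<^bsub>M\<^esub> (\<sigma> ^^ k) e"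
        by (simp add: conv_const_right conv_closed pM gR e)
      also have "\<dots> = (\<Oplus>\<^bsub>M\<^esub>i\<in>{..k}. (p i \<cdot>\<^bsub>M\<^esub> (\<sigma> ^^ i) (g (k - i))) \<cdot>\<^bsub>M\<^esub> (\<sigma> ^^ k) e)"
        unfolding skew_conv_def by (rule finsum_rsmult) (use pM gR e in auto)
      also have "\<dots> = \<zero>\<^bsub>M\<^esub>"
        by (rule M.finsum_eq_zero) (use kill gR in auto)
      finally show "((p \<star> g) \<star> const R e) k = \<zero>\<^bsub>M\<^esub>" .
    qed
    moreover have "const R e \<diamondop> f = f"
      if f: "f \<in> up R" and ann: "\<forall>g\<in>up R. (p \<star> g) \<star> f = (\<lambda>k. \<zero>\<^bsub>M\<^esub>)" for f
    proof -
      note fR = mem_upD[OF f]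
      have "(p \<star> (\<lambda>j. r \<otimes>\<^bsub>R\<^esub> f j)) k = \<zero>\<^bsub>M\<^esub>" if r: "r \<in> carrier R" for r k
      proof -
        \<comment> \<open>\<open>const R r \<diamondop> f\<close> is \<open>f\<close> scaled on the
          left by \<open>r\<close>, so testing \<open>f\<close> against constants gives the
          hypothesis of \<open>coeffwise_ann\<close>.\<close>
        have "(p \<star> const R r) \<star> f = p \<star> (const R r \<diamondop> f)"
          by (rule conv_assoc[symmetric]) (use pM fR r in auto)
        then show ?thesis
          using ann const_mem_up[of r R] r fR by (simp add: rconv_const_left fun_eq_iff)
      qed
      note coeffwise = coeffwise_ann[of p f, OF pq C2 pM fR this]
      have "e \<otimes>\<^bsub>R\<^esub> f j = f j" for j
        by (rule fixd[rule_format]) (simp_all add: fR coeffwise)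
      then show ?thesis
        by (simp add: rconv_const_left e fR)
    qed
    ultimately have "P.ann_generator p (const R e)"
      using const_mem_up[of e R] e
      unfolding P.ann_generator_def
      by (simp add: skew_poly_ring_def skew_ring_on_def
          skew_poly_module_def skew_module_on_def)
    then show ?thesis by blast
  qed
  then show ?thesis
    unfolding P.pq_Baer_module_iff by (simp add: skew_poly_module_def skew_module_on_def)
qed

section \<open>Passing from skew polynomials or power series to the module\<close>

lemma C1_pow:
  assumes "condition_C1 R M \<sigma>" "m \<in> carrier M" "a \<in> carrier R" "m \<cdot>\<^bsub>M\<^esub> a = \<zero>\<^bsub>M\<^esub>"
  shows "m \<cdot>\<^bsub>M\<^esub> (\<sigma> ^^ i) a = \<zero>\<^bsub>M\<^esub>"
  using assms by (induction i) (auto simp: condition_C1_def)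

text \<open>The generator for \<open>m\<close> is the constant coefficient of a generator for the
  constant series \<open>m\<close>. The carriers \<open>C\<close> and \<open>D\<close> are left
  open, so that one argument covers polynomials and power series.\<close>

lemma pq_Baer_descends:
  assumes pq: "pq_Baer_module (skew_ring_on C R \<sigma>) (skew_module_on D M \<sigma>)"
    and C1: "condition_C1 R M \<sigma>"
    and C: "C \<subseteq> UNIV \<rightarrow> carrier R"
    and const_C: "\<And>a. a \<in> carrier R \<Longrightarrow> const R a \<in> C"
    and const_D: "\<And>m. m \<in> carrier M \<Longrightarrow> const M m \<in> D"
  shows "pq_Baer_module R M"
proof -
  interpret P: pq_Baer_module "skew_ring_on C R \<sigma>" "skew_module_on D M \<sigma>"
    by (rule pq)
  have "\<exists>e. ann_generator m e" if m: "m \<in> carrier M" for m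
  proof -
    have "const M m \<in> carrier (skew_module_on D M \<sigma>)"
      using const_D[OF m] by (simp add: skew_module_on_def)
    then obtain e where "P.ann_generator (const M m) e"
      using pq unfolding P.pq_Baer_module_iff by blast
    then have e: "e \<in> C"
      and kill: "\<And>g. g \<in> C \<Longrightarrow> (const M m \<star> g) \<star> e = (\<lambda>k. \<zero>\<^bsub>M\<^esub>)"
      and fixd: "\<And>f. f \<in> C \<Longrightarrow> (\<And>g. g \<in> C \<Longrightarrow> (const M m \<star> g) \<star> f = (\<lambda>k. \<zero>\<^bsub>M\<^esub>)) \<Longrightarrow> e \<diamondop> f = f"
      unfolding P.ann_generator_def by (auto simp: skew_ring_on_def skew_module_on_def)
    have CR: "g i \<in> carrier R" if "g \<in> C" for g i
      using that C by auto
    have "(m \<cdot>\<^bsub>M\<^esub> r) \<cdot>\<^bsub>M\<^esub> e 0 = \<zero>\<^bsub>M\<^esub>" if r: "r \<in> carrier R" for r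
    proof -
      \<comment> \<open>Constant multipliers suffice here: the claim is degree zero of
        \<open>(m r) e = 0\<close>.\<close>
      have "const M m \<star> const R r = const M (m \<cdot>\<^bsub>M\<^esub> r)"
        using m r by (subst conv_const_left) auto
      then have "(\<lambda>k. (m \<cdot>\<^bsub>M\<^esub> r) \<cdot>\<^bsub>M\<^esub> e k) = (\<lambda>k. \<zero>\<^bsub>M\<^esub>)"
        using kill[OF const_C[OF r]] conv_const_left[of "m \<cdot>\<^bsub>M\<^esub> r" e] m r CR[OF e] by simp
      then show ?thesis by (rule fun_cong)
    qed
    moreover have "e 0 \<otimes>\<^bsub>R\<^esub> b = b"
      if b: "b \<in> carrier R" and ann: "\<forall>r\<in>carrier R. (m \<cdot>\<^bsub>M\<^esub> r) \<cdot>\<^bsub>M\<^esub> b = \<zero>\<^bsub>M\<^esub>" for b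
    proof -
      \<comment> \<open>Coefficient \<open>k\<close> is \<open>m (g k)\<close> times
        \<open>(\<sigma> ^^ k) b\<close>, and \<open>C\<^sub>1\<close> deduces its vanishing from
        \<open>m (g k) b = 0\<close>.\<close>
      have "(const M m \<star> g) \<star> const R b = (\<lambda>k. \<zero>\<^bsub>M\<^esub>)" if g: "g \<in> C" for g
        using m b CR[OF g] ann C1_pow[OF C1 _ b] by (simp add: conv_const_left conv_const_right)
      then have "e \<diamondop> const R b = const R b"
        by (intro fixd const_C b)
      then have "(\<lambda>k. e k \<otimes>\<^bsub>R\<^esub> (\<sigma> ^^ k) b) = const R b"
        using CR[OF e] b by (simp add: rconv_const_right)
      \<comment> \<open>In degree zero no power of \<open>\<sigma>\<close> acts on
        \<open>b\<close>.\<close>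
      from fun_cong[OF this, of 0] show ?thesis by simp
    qed
    ultimately have "ann_generator m (e 0)"
      using CR[OF e] by (simp add: ann_generator_def)
    then show ?thesis ..
  qed
  then show ?thesis
    unfolding pq_Baer_module_iff by blast
qed

end

theorem proposition2p3:
  fixes R :: "('a, 'r) ring_scheme"
    and M :: "('a, 'm, 'n) right_module_scheme"
    and \<sigma> :: "'a \<Rightarrow> 'a"
  assumes "right_module R M"
    and "\<sigma> \<in> ring_hom R R"
  shows "(pq_Baer_module R M \<and> condition_C2 R M \<sigma>
            \<longrightarrow> pq_Baer_module (skew_poly_ring R \<sigma>) (skew_poly_module M \<sigma>))
       \<and> ((pq_Baer_module (skew_poly_ring R \<sigma>) (skew_poly_module M \<sigma>)
            \<or> pq_Baer_module (skew_power_series_ring R \<sigma>) (skew_power_series_module M \<sigma>))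
          \<and> condition_C1 R M \<sigma>
            \<longrightarrow> pq_Baer_module R M)"
proof -
  interpret skew_module R M \<sigma>
    using assms by (intro skew_module.intro skew_module_axioms.intro)
  have "pq_Baer_module R M" if C1: "condition_C1 R M \<sigma>"
    and "pq_Baer_module (skew_poly_ring R \<sigma>) (skew_poly_module M \<sigma>)"
    using that(2) unfolding skew_poly_ring_def skew_poly_module_def
    by (rule pq_Baer_descends[OF _ C1]) (auto simp: up_def intro: const_mem_up)
  moreover have "pq_Baer_module R M" if C1: "condition_C1 R M \<sigma>"
    and "pq_Baer_module (skew_power_series_ring R \<sigma>) (skew_power_series_module M \<sigma>)"
    using that(2) unfolding skew_power_series_ring_def skew_power_series_module_def
    by (rule pq_Baer_descends[OF _ C1]) auto
  ultimately show ?thesis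
    using pq_Baer_skew_poly by blast
qed

end
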